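(* Let $Q$ be a nonassociative CC-loop with nucleus $N(Q)$. Then the center $Z(N(Q))$ of the group $N(Q)$ is nontrivial, and it contains the subgroup generated by all associators $(x,y,z)$ and $[x,y,z]$, $x,y,z\in Q$ (in particular all associators lie in $N(Q)$).
   Context: A loop is a set $Q$ with a binary operation having a two-sided identity $1$ such that all equations $xu=y$ and $vx=y$ have unique solutions $u=x\backslash y$ and $v=y/x$. Here $x\cdot yz$ means $x(yz)$ and $xy\cdot z$ means $(xy)z$. A loop $Q$ is conjugacy closed (a CC-loop) if there are functions $f,g:Q\times Q\to Q$ such that for all $x,y,z\in Q$: $x\cdot yz=f(x,y)\cdot xz$ and $zy\cdot x=zx\cdot g(x,y)$. The nucleus $N(Q)$ is the set of $a\in Q$ such that for all $x,y\in Q$: $a\cdot xy=ax\cdot y$, $xa\cdot y=x\cdot ay$ and $x\cdot ya=xy\cdot a$; it is a group. Associators are defined by $(x,y,z):=(x\cdot yz)\backslash(xy\cdot z)$ and $[x,y,z]:=(x\cdot yz)/(xy\cdot z)$. *)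

theory Defs
  imports "HOL-Algebra.Generated_Groups"
begin

text \<open>
  Loops reuse the record of monoids; nothing here assumes associativity.  The notions
  below are definitions on records (rather than inside the locale), so that the nucleus can be
  handled as a record of its own with the tools for groups.
\<close>

locale loop =
  fixes Q (structure)
  assumes loop_closed: "\<lbrakk>x \<in> carrier Q; y \<in> carrier Q\<rbrakk> \<Longrightarrow> x \<otimes> y \<in> carrier Q"
    and loop_one_closed: "\<one> \<in> carrier Q"
    and loop_l_one: "x \<in> carrier Q \<Longrightarrow> \<one> \<otimes> x = x"
    and loop_r_one: "x \<in> carrier Q \<Longrightarrow> x \<otimes> \<one> = x"
    and loop_left_div: "\<lbrakk>x \<in> carrier Q; y \<in> carrier Q\<rbrakk> \<Longrightarrow> \<exists>!u. u \<in> carrier Q \<and> x \<otimes> u = y"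
    and loop_right_div: "\<lbrakk>x \<in> carrier Q; y \<in> carrier Q\<rbrakk> \<Longrightarrow> \<exists>!v. v \<in> carrier Q \<and> v \<otimes> x = y"

locale cc_loop = loop +
  assumes left_conj_closed:
    "\<exists>f \<in> carrier Q \<rightarrow> carrier Q \<rightarrow> carrier Q. \<forall>x\<in>carrier Q. \<forall>y\<in>carrier Q. \<forall>z\<in>carrier Q.
       x \<otimes> (y \<otimes> z) = f x y \<otimes> (x \<otimes> z)"
    and right_conj_closed:
    "\<exists>g \<in> carrier Q \<rightarrow> carrier Q \<rightarrow> carrier Q. \<forall>x\<in>carrier Q. \<forall>y\<in>carrier Q. \<forall>z\<in>carrier Q.
       (z \<otimes> y) \<otimes> x = (z \<otimes> x) \<otimes> g x y"

definition loop_associative :: "('a, 'b) monoid_scheme \<Rightarrow> bool" where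
  "loop_associative Q \<longleftrightarrow> (\<forall>x\<in>carrier Q. \<forall>y\<in>carrier Q. \<forall>z\<in>carrier Q.
     x \<otimes>\<^bsub>Q\<^esub> (y \<otimes>\<^bsub>Q\<^esub> z) = (x \<otimes>\<^bsub>Q\<^esub> y) \<otimes>\<^bsub>Q\<^esub> z)"

(* ldiv Q x y is x\y, the solution of x u = y. *)
definition ldiv :: "('a, 'b) monoid_scheme \<Rightarrow> 'a \<Rightarrow> 'a \<Rightarrow> 'a" where
  "ldiv Q x y = (THE u. u \<in> carrier Q \<and> x \<otimes>\<^bsub>Q\<^esub> u = y)"

(* rdiv Q y x is y/x, the solution of v x = y; the divisor is the second argument. *)
definition rdiv :: "('a, 'b) monoid_scheme \<Rightarrow> 'a \<Rightarrow> 'a \<Rightarrow> 'a" where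
  "rdiv Q y x = (THE v. v \<in> carrier Q \<and> v \<otimes>\<^bsub>Q\<^esub> x = y)"

(* (x,y,z) *)
definition lassociator :: "('a, 'b) monoid_scheme \<Rightarrow> 'a \<Rightarrow> 'a \<Rightarrow> 'a \<Rightarrow> 'a" where
  "lassociator Q x y z = ldiv Q (x \<otimes>\<^bsub>Q\<^esub> (y \<otimes>\<^bsub>Q\<^esub> z)) ((x \<otimes>\<^bsub>Q\<^esub> y) \<otimes>\<^bsub>Q\<^esub> z)"

(* [x,y,z] *)
definition rassociator :: "('a, 'b) monoid_scheme \<Rightarrow> 'a \<Rightarrow> 'a \<Rightarrow> 'a \<Rightarrow> 'a" where
  "rassociator Q x y z = rdiv Q (x \<otimes>\<^bsub>Q\<^esub> (y \<otimes>\<^bsub>Q\<^esub> z)) ((x \<otimes>\<^bsub>Q\<^esub> y) \<otimes>\<^bsub>Q\<^esub> z)"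

definition associators :: "('a, 'b) monoid_scheme \<Rightarrow> 'a set" where
  "associators Q =
     {lassociator Q x y z | x y z. x \<in> carrier Q \<and> y \<in> carrier Q \<and> z \<in> carrier Q} \<union>
     {rassociator Q x y z | x y z. x \<in> carrier Q \<and> y \<in> carrier Q \<and> z \<in> carrier Q}"

definition nucleus :: "('a, 'b) monoid_scheme \<Rightarrow> 'a set" where
  "nucleus Q = {a \<in> carrier Q. \<forall>x\<in>carrier Q. \<forall>y\<in>carrier Q.
     a \<otimes>\<^bsub>Q\<^esub> (x \<otimes>\<^bsub>Q\<^esub> y) = (a \<otimes>\<^bsub>Q\<^esub> x) \<otimes>\<^bsub>Q\<^esub> y \<and>
     (x \<otimes>\<^bsub>Q\<^esub> a) \<otimes>\<^bsub>Q\<^esub> y = x \<otimes>\<^bsub>Q\<^esub> (a \<otimes>\<^bsub>Q\<^esub> y) \<and>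
     x \<otimes>\<^bsub>Q\<^esub> (y \<otimes>\<^bsub>Q\<^esub> a) = (x \<otimes>\<^bsub>Q\<^esub> y) \<otimes>\<^bsub>Q\<^esub> a}"

abbreviation nucleus_group :: "('a, 'b) monoid_scheme \<Rightarrow> ('a, 'b) monoid_scheme" where
  "nucleus_group Q \<equiv> Q\<lparr>carrier := nucleus Q\<rparr>"

definition group_center :: "('a, 'b) monoid_scheme \<Rightarrow> 'a set" where
  "group_center G = {z \<in> carrier G. \<forall>x\<in>carrier G. z \<otimes>\<^bsub>G\<^esub> x = x \<otimes>\<^bsub>G\<^esub> z}"

lemma (in loop) ldiv:
  assumes "x \<in> carrier Q" "y \<in> carrier Q"
  shows "ldiv Q x y \<in> carrier Q" "x \<otimes> ldiv Q x y = y"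
  using theI'[OF loop_left_div[OF assms]] unfolding ldiv_def by auto

lemma (in loop) rdiv:
  assumes "x \<in> carrier Q" "y \<in> carrier Q"
  shows "rdiv Q y x \<in> carrier Q" "rdiv Q y x \<otimes> x = y"
  using theI'[OF loop_right_div[OF assms]] unfolding rdiv_def by auto

lemma (in loop) loop_l_cancel:
  assumes "x \<otimes> u = x \<otimes> v" "x \<in> carrier Q" "u \<in> carrier Q" "v \<in> carrier Q"
  shows "u = v"
  using loop_left_div[of x "x \<otimes> v"] assms loop_closed by auto

lemma (in loop) loop_r_cancel:
  assumes "u \<otimes> x = v \<otimes> x" "x \<in> carrier Q" "u \<in> carrier Q" "v \<in> carrier Q"
  shows "u = v"
  using loop_right_div[of x "v \<otimes> x"] assms loop_closed by auto

lemma (in loop) nucleusD: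
  assumes "a \<in> nucleus Q"
  shows "a \<in> carrier Q"
    and "\<lbrakk>x \<in> carrier Q; y \<in> carrier Q\<rbrakk> \<Longrightarrow> a \<otimes> (x \<otimes> y) = (a \<otimes> x) \<otimes> y"
    and "\<lbrakk>x \<in> carrier Q; y \<in> carrier Q\<rbrakk> \<Longrightarrow> (x \<otimes> a) \<otimes> y = x \<otimes> (a \<otimes> y)"
    and "\<lbrakk>x \<in> carrier Q; y \<in> carrier Q\<rbrakk> \<Longrightarrow> x \<otimes> (y \<otimes> a) = (x \<otimes> y) \<otimes> a"
  using assms unfolding nucleus_def by auto

lemma (in loop) nucleusI:
  assumes "a \<in> carrier Q"
    and "\<And>x y. \<lbrakk>x \<in> carrier Q; y \<in> carrier Q\<rbrakk> \<Longrightarrow> a \<otimes> (x \<otimes> y) = (a \<otimes> x) \<otimes> y"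
    and "\<And>x y. \<lbrakk>x \<in> carrier Q; y \<in> carrier Q\<rbrakk> \<Longrightarrow> (x \<otimes> a) \<otimes> y = x \<otimes> (a \<otimes> y)"
    and "\<And>x y. \<lbrakk>x \<in> carrier Q; y \<in> carrier Q\<rbrakk> \<Longrightarrow> x \<otimes> (y \<otimes> a) = (x \<otimes> y) \<otimes> a"
  shows "a \<in> nucleus Q"
  unfolding nucleus_def by (intro CollectI conjI ballI assms)

lemma (in loop) nucleus_mult_closed:
  assumes a: "a \<in> nucleus Q" and b: "b \<in> nucleus Q"
  shows "a \<otimes> b \<in> nucleus Q"
proof -
  note A = nucleusD[OF a] and B = nucleusD[OF b] and cl = loop_closed
  have "(a \<otimes> b) \<otimes> (x \<otimes> y) = ((a \<otimes> b) \<otimes> x) \<otimes> y" if x: "x \<in> carrier Q" and y: "y \<in> carrier Q" for x y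
  proof -
    have "(a \<otimes> b) \<otimes> (x \<otimes> y) = a \<otimes> (b \<otimes> (x \<otimes> y))"
      using A(2)[OF B(1) cl[OF x y]] by (rule sym)
    also have "\<dots> = a \<otimes> ((b \<otimes> x) \<otimes> y)" using B(2)[OF x y] by (rule arg_cong)
    also have "\<dots> = (a \<otimes> (b \<otimes> x)) \<otimes> y" by (rule A(2)[OF cl[OF B(1) x] y])
    also have "a \<otimes> (b \<otimes> x) = (a \<otimes> b) \<otimes> x" by (rule A(2)[OF B(1) x])
    finally show ?thesis .
  qed
  moreover have "(x \<otimes> (a \<otimes> b)) \<otimes> y = x \<otimes> ((a \<otimes> b) \<otimes> y)"
    if x: "x \<in> carrier Q" and y: "y \<in> carrier Q" for x y
  proof -
    have "x \<otimes> (a \<otimes> b) = (x \<otimes> a) \<otimes> b" by (rule B(4)[OF x A(1)])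
    then have "(x \<otimes> (a \<otimes> b)) \<otimes> y = ((x \<otimes> a) \<otimes> b) \<otimes> y" by (rule arg_cong)
    also have "\<dots> = (x \<otimes> a) \<otimes> (b \<otimes> y)" by (rule B(3)[OF cl[OF x A(1)] y])
    also have "\<dots> = x \<otimes> (a \<otimes> (b \<otimes> y))" by (rule A(3)[OF x cl[OF B(1) y]])
    also have "a \<otimes> (b \<otimes> y) = (a \<otimes> b) \<otimes> y" by (rule A(2)[OF B(1) y])
    finally show ?thesis .
  qed
  moreover have "x \<otimes> (y \<otimes> (a \<otimes> b)) = (x \<otimes> y) \<otimes> (a \<otimes> b)"
    if x: "x \<in> carrier Q" and y: "y \<in> carrier Q" for x y
  proof -
    have "y \<otimes> (a \<otimes> b) = (y \<otimes> a) \<otimes> b" by (rule B(4)[OF y A(1)])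
    then have "x \<otimes> (y \<otimes> (a \<otimes> b)) = x \<otimes> ((y \<otimes> a) \<otimes> b)" by (rule arg_cong)
    also have "\<dots> = (x \<otimes> (y \<otimes> a)) \<otimes> b" by (rule B(4)[OF x cl[OF y A(1)]])
    also have "x \<otimes> (y \<otimes> a) = (x \<otimes> y) \<otimes> a" by (rule A(4)[OF x y])
    also have "((x \<otimes> y) \<otimes> a) \<otimes> b = (x \<otimes> y) \<otimes> (a \<otimes> b)"
      by (rule B(4)[OF cl[OF x y] A(1), symmetric])
    finally show ?thesis .
  qed
  ultimately show ?thesis
    by (rule nucleusI[OF cl[OF A(1) B(1)]])
qed

lemma (in loop) nucleus_inverse:
  assumes a: "a \<in> nucleus Q"
  shows "\<exists>b \<in> nucleus Q. b \<otimes> a = \<one>"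
proof -
  note A = nucleusD[OF a] and cl = loop_closed
  obtain b where b: "b \<in> carrier Q" and ab: "a \<otimes> b = \<one>"
    using loop_left_div[OF A(1) loop_one_closed] by blast
  have "a \<otimes> (b \<otimes> a) = a \<otimes> \<one>"
    using A(1) A(2)[OF b A(1)] ab by (simp add: loop_l_one loop_r_one)
  then have ba: "b \<otimes> a = \<one>"
    using loop_l_cancel A(1) b cl loop_one_closed by blast
  have aba: "a \<otimes> (b \<otimes> x) = x" if "x \<in> carrier Q" for x
    using A(2)[OF b that] ab that by (simp add: loop_l_one)
  have xba: "(x \<otimes> b) \<otimes> a = x" if "x \<in> carrier Q" for x
    using A(4)[OF that b] ba that by (simp add: loop_r_one)
  have "b \<otimes> (x \<otimes> y) = (b \<otimes> x) \<otimes> y" if xy: "x \<in> carrier Q" "y \<in> carrier Q" for x y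
  proof (rule loop_l_cancel[OF _ A(1)])
    show "a \<otimes> (b \<otimes> (x \<otimes> y)) = a \<otimes> ((b \<otimes> x) \<otimes> y)"
      using xy b A(2)[OF cl[OF b xy(1)] xy(2)] by (simp add: aba cl)
  qed (use xy b cl in auto)
  moreover have "(x \<otimes> b) \<otimes> y = x \<otimes> (b \<otimes> y)" if xy: "x \<in> carrier Q" "y \<in> carrier Q" for x y
  proof -
    have "(x \<otimes> b) \<otimes> (a \<otimes> (b \<otimes> y)) = ((x \<otimes> b) \<otimes> a) \<otimes> (b \<otimes> y)"
      using A(3)[OF cl[OF xy(1) b] cl[OF b xy(2)]] by (rule sym)
    then show ?thesis using xy by (simp add: aba xba)
  qed
  moreover have "x \<otimes> (y \<otimes> b) = (x \<otimes> y) \<otimes> b" if xy: "x \<in> carrier Q" "y \<in> carrier Q" for x y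
  proof (rule loop_r_cancel[OF _ A(1)])
    show "(x \<otimes> (y \<otimes> b)) \<otimes> a = ((x \<otimes> y) \<otimes> b) \<otimes> a"
      unfolding A(4)[OF xy(1) cl[OF xy(2) b], symmetric] xba[OF xy(2)] xba[OF cl[OF xy]]
      by (rule refl)
  qed (use xy b cl in auto)
  ultimately have "b \<in> nucleus Q"
    by (rule nucleusI[OF b])
  then show ?thesis using ba by blast
qed

lemma (in loop) nucleus_is_group: "group (nucleus_group Q)"
proof (rule groupI)
  show "\<one>\<^bsub>nucleus_group Q\<^esub> \<in> carrier (nucleus_group Q)"
    unfolding nucleus_def by (simp add: loop_one_closed loop_l_one loop_r_one loop_closed)
next
  fix x y z
  assume "x \<in> carrier (nucleus_group Q)" "y \<in> carrier (nucleus_group Q)"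
    "z \<in> carrier (nucleus_group Q)"
  then show "(x \<otimes>\<^bsub>nucleus_group Q\<^esub> y) \<otimes>\<^bsub>nucleus_group Q\<^esub> z =
      x \<otimes>\<^bsub>nucleus_group Q\<^esub> (y \<otimes>\<^bsub>nucleus_group Q\<^esub> z)"
    using nucleusD(2)[of x y z] nucleusD(1) by simp
qed (auto simp: nucleus_mult_closed nucleus_inverse nucleusD(1) loop_l_one)

lemma (in group) group_center_subgroup: "subgroup (group_center G) G"
proof
  fix x assume x: "x \<in> group_center G"
  have "inv x \<otimes> y = y \<otimes> inv x" if y: "y \<in> carrier G" for y
  proof -
    have "x \<in> carrier G" "x \<otimes> inv y = inv y \<otimes> x"
      using x y unfolding group_center_def by auto
    then have "inv (x \<otimes> inv y) = inv (inv y \<otimes> x)" by simp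
    then show ?thesis using \<open>x \<in> carrier G\<close> y by (simp add: inv_mult_group)
  qed
  then show "inv x \<in> group_center G"
    using x unfolding group_center_def by auto
next
  fix x y assume xy: "x \<in> group_center G" "y \<in> group_center G"
  then have c: "x \<in> carrier G" "y \<in> carrier G" unfolding group_center_def by auto
  have "(x \<otimes> y) \<otimes> z = z \<otimes> (x \<otimes> y)" if z: "z \<in> carrier G" for z
  proof -
    have comm: "y \<otimes> z = z \<otimes> y" "x \<otimes> z = z \<otimes> x"
      using xy z unfolding group_center_def by auto
    have "(x \<otimes> y) \<otimes> z = x \<otimes> (z \<otimes> y)"
      unfolding comm(1)[symmetric] by (rule m_assoc[OF c z])
    also have "\<dots> = (x \<otimes> z) \<otimes> y" by (rule m_assoc[OF c(1) z c(2), symmetric])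
    also have "\<dots> = z \<otimes> (x \<otimes> y)" unfolding comm(2) by (rule m_assoc[OF z c])
    finally show ?thesis .
  qed
  then show "x \<otimes> y \<in> group_center G"
    using c unfolding group_center_def by auto
qed (auto simp: group_center_def)

end

theory Submission
  imports Defs
begin

text \<open>
  Write $T_x(y) = xy / x$.  The CC laws say that $(T_x, L_x, L_x)$ and $(R_x, T_x^{-1}, R_x)$ are
  autotopisms.  Two products of such autotopisms have the third component $z \mapsto y(zx)$, and
  autotopisms with equal third component differ by an element of the nucleus $N$; comparing their
  first components at $y$ gives $yx \in T_y(yx)N$.  Hence multiplication is commutative modulo $N$,
  and the left CC law turns into $x \cdot yz \equiv y \cdot xz$, so that
  $x \cdot yz \equiv x \cdot zy \equiv z \cdot xy \equiv xy \cdot z$: associators are nuclear.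
  An associator does not change when one argument is multiplied by some $n \in N$ on the left,
  while $(x,y,zn) = n^{-1}(x,y,z)n$; as $zN = Nz$, it commutes with $n$.
\<close>

section \<open>Conjugation maps and cosets of the nucleus in an arbitrary loop\<close>

context loop
begin

definition conj_map :: "'a \<Rightarrow> 'a \<Rightarrow> 'a" where
  "conj_map x y = rdiv Q (x \<otimes> y) x"

text \<open>This is $T_x^{-1}$, given by a formula of its own because it is the map that appears in
  the right CC law; in a group it is conjugation by the inverse of \<open>x\<close>.\<close>

definition conj_inv :: "'a \<Rightarrow> 'a \<Rightarrow> 'a" where
  "conj_inv x y = ldiv Q x (y \<otimes> x)"

lemma conj_map:
  assumes "x \<in> carrier Q" "y \<in> carrier Q"
  shows "conj_map x y \<in> carrier Q" "conj_map x y \<otimes> x = x \<otimes> y"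
  using assms by (simp_all add: conj_map_def rdiv loop_closed)

lemma conj_inv:
  assumes "x \<in> carrier Q" "y \<in> carrier Q"
  shows "conj_inv x y \<in> carrier Q" "x \<otimes> conj_inv x y = y \<otimes> x"
  using assms by (simp_all add: conj_inv_def ldiv loop_closed)

lemma conj_map_conj_inv:
  assumes "x \<in> carrier Q" "y \<in> carrier Q"
  shows "conj_map x (conj_inv x y) = y"
  using loop_r_cancel[of "conj_map x (conj_inv x y)" x y] assms by (simp add: conj_map conj_inv)

lemma conj_inv_conj_map:
  assumes "x \<in> carrier Q" "y \<in> carrier Q"
  shows "conj_inv x (conj_map x y) = y"
  using loop_l_cancel[of x "conj_inv x (conj_map x y)" y] assms by (simp add: conj_map conj_inv)

lemma conj_map_self:
  assumes "x \<in> carrier Q"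
  shows "conj_map x x = x"
  using loop_r_cancel[of "conj_map x x" x x] assms by (simp add: conj_map)

lemma ldiv_unique:
  assumes "x \<otimes> u = y" "x \<in> carrier Q" "u \<in> carrier Q"
  shows "ldiv Q x y = u"
  using loop_l_cancel[of x "ldiv Q x y" u] assms ldiv[of x y] loop_closed by auto

lemma rdiv_unique:
  assumes "v \<otimes> x = y" "x \<in> carrier Q" "v \<in> carrier Q"
  shows "rdiv Q y x = v"
  using loop_r_cancel[of "rdiv Q y x" x v] assms rdiv[of x y] loop_closed by auto

lemma nucleus_r_inverse:
  assumes "a \<in> nucleus Q"
  shows "\<exists>b\<in>nucleus Q. a \<otimes> b = \<one>"
proof -
  interpret N: group "nucleus_group Q" by (rule nucleus_is_group)
  show ?thesis using N.r_inv_ex[of a] assms by simp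
qed

text \<open>Putting \<open>u = \<one>\<close> shows that left multiplication by \<open>n\<close>
  undoes left multiplication by \<open>m\<close>. Writing an arbitrary \<open>v\<close> as
  \<open>m \<otimes> w\<close> therefore gives \<open>w = n \<otimes> v\<close>, and the hypothesis
  becomes the claim.\<close>

lemma middle_nuclear_of_inverse_pair:
  assumes m: "m \<in> carrier Q" and n: "n \<in> carrier Q"
    and uv: "\<And>u v. u \<in> carrier Q \<Longrightarrow> v \<in> carrier Q \<Longrightarrow> (u \<otimes> n) \<otimes> (m \<otimes> v) = u \<otimes> v"
    and u: "u \<in> carrier Q" and v: "v \<in> carrier Q"
  shows "(u \<otimes> n) \<otimes> v = u \<otimes> (n \<otimes> v)"
proof -
  have nm: "n \<otimes> (m \<otimes> w) = w" if "w \<in> carrier Q" for w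
    using uv[of \<one> w] that m n by (simp add: loop_one_closed loop_l_one loop_closed)
  obtain w where w: "w \<in> carrier Q" "m \<otimes> w = v"
    using loop_left_div[OF m v] by blast
  then have "n \<otimes> v = w" using nm by blast
  then show ?thesis using uv[OF u w(1)] w by simp
qed

text \<open>Membership of \<open>x\<close> in the left coset $yN$. In a general loop it is
  compatible only with multiplication on the left; the other side needs $N$ to be normal.\<close>

definition nuc_equiv :: "'a \<Rightarrow> 'a \<Rightarrow> bool" where
  "nuc_equiv x y \<longleftrightarrow> (\<exists>n\<in>nucleus Q. x = y \<otimes> n)"

lemma nuc_equiv_sym:
  assumes "nuc_equiv x y" "y \<in> carrier Q"
  shows "nuc_equiv y x"
proof -
  obtain n where n: "n \<in> nucleus Q" "x = y \<otimes> n" using assms unfolding nuc_equiv_def by blast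
  obtain b where b: "b \<in> nucleus Q" "n \<otimes> b = \<one>" using nucleus_r_inverse[OF n(1)] by blast
  have "x \<otimes> b = y"
    using nucleusD(3)[OF n(1) assms(2) nucleusD(1)[OF b(1)]] n b assms(2) by (simp add: loop_r_one)
  then show ?thesis using b(1) unfolding nuc_equiv_def by blast
qed

lemma nuc_equiv_trans:
  assumes "nuc_equiv x y" "nuc_equiv y z" "z \<in> carrier Q"
  shows "nuc_equiv x z"
proof -
  obtain n where n: "n \<in> nucleus Q" "x = y \<otimes> n" using assms(1) unfolding nuc_equiv_def by blast
  obtain m where m: "m \<in> nucleus Q" "y = z \<otimes> m" using assms(2) unfolding nuc_equiv_def by blast
  have "x = z \<otimes> (m \<otimes> n)"
    using nucleusD(3)[OF m(1) assms(3) nucleusD(1)[OF n(1)]] n m by simp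
  then show ?thesis using nucleus_mult_closed[OF m(1) n(1)] unfolding nuc_equiv_def by blast
qed

lemma nuc_equiv_mult_left:
  assumes "nuc_equiv x y" "y \<in> carrier Q" "z \<in> carrier Q"
  shows "nuc_equiv (z \<otimes> x) (z \<otimes> y)"
  using assms nucleusD(4) unfolding nuc_equiv_def by metis

end

section \<open>The CC laws as autotopisms\<close>

context cc_loop
begin

text \<open>The function in the left CC law is forced: \<open>z = \<one>\<close> shows that its
  value, multiplied by \<open>x\<close> on the right, is \<open>x \<otimes> y\<close>.\<close>

lemma lcc:
  assumes x: "x \<in> carrier Q" and y: "y \<in> carrier Q" and z: "z \<in> carrier Q"
  shows "x \<otimes> (y \<otimes> z) = conj_map x y \<otimes> (x \<otimes> z)"
proof -
  obtain f where fcl: "f \<in> carrier Q \<rightarrow> carrier Q \<rightarrow> carrier Q"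
    and feq: "\<forall>x\<in>carrier Q. \<forall>y\<in>carrier Q. \<forall>z\<in>carrier Q. x \<otimes> (y \<otimes> z) = f x y \<otimes> (x \<otimes> z)"
    by (rule bexE[OF left_conj_closed])
  have f: "f x y \<in> carrier Q"
    "\<And>z. z \<in> carrier Q \<Longrightarrow> x \<otimes> (y \<otimes> z) = f x y \<otimes> (x \<otimes> z)"
    using funcset_mem[OF funcset_mem[OF fcl x] y] feq x y by blast+
  have "f x y \<otimes> x = x \<otimes> y" using f(2)[OF loop_one_closed] x y by (simp add: loop_r_one)
  then have "conj_map x y = f x y" using f(1) x by (simp add: conj_map_def rdiv_unique)
  then show ?thesis using f(2)[OF z] by simp
qed

text \<open>Again the case \<open>z = \<one>\<close> forces the function of the law, this time to be
  $T_x^{-1}$.\<close>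

lemma rcc:
  assumes x: "x \<in> carrier Q" and y: "y \<in> carrier Q" and z: "z \<in> carrier Q"
  shows "(z \<otimes> y) \<otimes> x = (z \<otimes> x) \<otimes> conj_inv x y"
proof -
  obtain g where gcl: "g \<in> carrier Q \<rightarrow> carrier Q \<rightarrow> carrier Q"
    and geq: "\<forall>x\<in>carrier Q. \<forall>y\<in>carrier Q. \<forall>z\<in>carrier Q. (z \<otimes> y) \<otimes> x = (z \<otimes> x) \<otimes> g x y"
    by (rule bexE[OF right_conj_closed])
  have g: "g x y \<in> carrier Q"
    "\<And>z. z \<in> carrier Q \<Longrightarrow> (z \<otimes> y) \<otimes> x = (z \<otimes> x) \<otimes> g x y"
    using funcset_mem[OF funcset_mem[OF gcl x] y] geq x y by blast+
  have "x \<otimes> g x y = y \<otimes> x" using g(2)[OF loop_one_closed] x y by (simp add: loop_l_one)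
  then have "conj_inv x y = g x y" using g(1) x by (simp add: conj_inv_def ldiv_unique)
  then show ?thesis using g(2)[OF z] by simp
qed

text \<open>In a CC-loop a middle nuclear element is nuclear: the CC laws for \<open>c\<close>
  replace one factor by its image under $T_c$ or $T_c^{-1}$, the middle law regroups, and the
  defining equation of that image removes the conjugation.\<close>

lemma nucleus_of_middle:
  assumes c: "c \<in> carrier Q"
    and mid: "\<And>u v. u \<in> carrier Q \<Longrightarrow> v \<in> carrier Q \<Longrightarrow> (u \<otimes> c) \<otimes> v = u \<otimes> (c \<otimes> v)"
  shows "c \<in> nucleus Q"
proof (rule nucleusI[OF c])
  fix x y assume xy: "x \<in> carrier Q" "y \<in> carrier Q"
  show "c \<otimes> (x \<otimes> y) = (c \<otimes> x) \<otimes> y"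
    unfolding lcc[OF c xy] mid[OF conj_map(1)[OF c xy(1)] xy(2), symmetric]
      conj_map(2)[OF c xy(1)] ..
  show "(x \<otimes> c) \<otimes> y = x \<otimes> (c \<otimes> y)" by (rule mid[OF xy])
  show "x \<otimes> (y \<otimes> c) = (x \<otimes> y) \<otimes> c"
    unfolding rcc[OF c xy(2,1)] mid[OF xy(1) conj_inv(1)[OF c xy(2)]]
      conj_inv(2)[OF c xy(2)] ..
qed

text \<open>Applied to the first two components of autotopisms with a common third component.\<close>

lemma nucleus_of_equal_products:
  assumes eq: "\<And>u z. u \<in> carrier Q \<Longrightarrow> z \<in> carrier Q \<Longrightarrow> f u \<otimes> g z = f' u \<otimes> g' z"
    and f: "f ` carrier Q = carrier Q" and g: "g ` carrier Q = carrier Q"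
    and f': "f' ` carrier Q = carrier Q" and g': "g' ` carrier Q = carrier Q"
  shows "\<exists>n\<in>nucleus Q. \<forall>u\<in>carrier Q. f' u = f u \<otimes> n"
proof -
  \<comment> \<open>At a point where one primed factor is \<open>\<one>\<close>, the hypothesis
    gives the other primed factor in terms of \<open>f\<close> and \<open>g\<close>:
    \<open>f'\<close> is \<open>f\<close> followed by right multiplication by \<open>n\<close>, and
    \<open>g'\<close> is \<open>g\<close> followed by left multiplication by
    \<open>m\<close>.\<close>
  obtain u0 where u0: "u0 \<in> carrier Q" "f' u0 = \<one>" using f' loop_one_closed by (metis imageE)
  obtain z0 where z0: "z0 \<in> carrier Q" "g' z0 = \<one>" using g' loop_one_closed by (metis imageE)
  define m where "m = f u0"
  define n where "n = g z0"
  have mn: "m \<in> carrier Q" "n \<in> carrier Q" using u0 z0 f g by (auto simp: m_def n_def)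
  have f'_eq: "f' u = f u \<otimes> n" if "u \<in> carrier Q" for u
    using eq[OF that z0(1)] loop_r_one[of "f' u"] imageI[OF that, of f'] by (simp add: f' z0 n_def)
  have g'_eq: "g' z = m \<otimes> g z" if "z \<in> carrier Q" for z
    using eq[OF u0(1) that] loop_l_one[of "g' z"] imageI[OF that, of g'] by (simp add: g' u0 m_def)
  \<comment> \<open>Since \<open>f\<close> and \<open>g\<close> are onto, the equality of products
    holds for arbitrary factors and makes \<open>n\<close> middle nuclear.\<close>
  have "(u \<otimes> n) \<otimes> (m \<otimes> v) = u \<otimes> v" if uv: "u \<in> carrier Q" "v \<in> carrier Q" for u v
  proof -
    obtain a b where "a \<in> carrier Q" "u = f a" "b \<in> carrier Q" "v = g b"
      using uv f g by (metis imageE)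
    then show ?thesis using eq[of a b] by (simp add: f'_eq g'_eq)
  qed
  then have "n \<in> nucleus Q"
    using middle_nuclear_of_inverse_pair[OF mn] nucleus_of_middle[OF mn(2)] by blast
  then show ?thesis using f'_eq by blast
qed

text \<open>The central step: conjugation moves an element only within its coset of the nucleus. Two
  autotopisms with third component $z \<mapsto> y(zx)$, where $w = yx$, are compared at the single
  point \<open>y\<close>.\<close>

lemma nuc_equiv_conj_map:
  assumes y: "y \<in> carrier Q" and w: "w \<in> carrier Q"
  shows "nuc_equiv w (conj_map y w)"
proof -
  note cl = loop_closed conj_map(1) conj_inv(1) ldiv(1) rdiv(1) loop_one_closed
  define x where "x = ldiv Q y w"
  have x: "x \<in> carrier Q" and yx: "y \<otimes> x = w" using ldiv[OF y w] by (auto simp: x_def)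
  \<comment> \<open>The pair \<open>f\<close>, \<open>g\<close> belongs to $(R_x, T_x^{-1}, R_x)$
    followed by $(T_y, L_y, L_y)$. For \<open>f'\<close>, \<open>g'\<close>, take $(T_y, L_y, L_y)$
    followed by the inverse of $(R_y, T_y^{-1}, R_y)$, which has third component $T_y$, and then
    apply $(R_w, T_w^{-1}, R_w)$.\<close>
  define f where "f u = conj_map y (u \<otimes> x)" for u
  define g where "g z = y \<otimes> conj_inv x z" for z
  define f' where "f' u = rdiv Q (conj_map y u) y \<otimes> w" for u
  define g' where "g' z = conj_inv w (conj_map y (y \<otimes> z))" for z
  have fcl: "f u \<in> carrier Q" "g u \<in> carrier Q" "f' u \<in> carrier Q" "g' u \<in> carrier Q"
    if "u \<in> carrier Q" for u
    using that x y w by (simp_all add: f_def g_def f'_def g'_def cl)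
  have eq: "f u \<otimes> g z = f' u \<otimes> g' z" if u: "u \<in> carrier Q" and z: "z \<in> carrier Q" for u z
  proof -
    define a where "a = rdiv Q (conj_map y u) y"
    have a: "a \<in> carrier Q" "a \<otimes> y = conj_map y u"
      using rdiv[OF y conj_map(1)[OF y u]] by (auto simp: a_def)
    have "f u \<otimes> g z = y \<otimes> ((u \<otimes> x) \<otimes> conj_inv x z)"
      unfolding f_def g_def using lcc[OF y, of "u \<otimes> x" "conj_inv x z"] u z x by (simp add: cl)
    then have 1: "f u \<otimes> g z = y \<otimes> ((u \<otimes> z) \<otimes> x)"
      using rcc[OF x z u] by simp
    \<comment> \<open>Multiplying by \<open>y\<close> on the right reduces the autotopism with third
      component $T_y$ to the two CC laws.\<close>
    have "(a \<otimes> conj_map y (y \<otimes> z)) \<otimes> y = conj_map y u \<otimes> (y \<otimes> z)"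
      using rcc[OF y _ a(1), of "conj_map y (y \<otimes> z)"] a z y by (simp add: cl conj_inv_conj_map)
    also have "\<dots> = y \<otimes> (u \<otimes> z)" by (rule lcc[OF y u z, symmetric])
    finally have "conj_map y (u \<otimes> z) = a \<otimes> conj_map y (y \<otimes> z)"
      using a u z y by (simp add: conj_map_def[of y "u \<otimes> z"] rdiv_unique cl)
    then have "f' u \<otimes> g' z = conj_map y (u \<otimes> z) \<otimes> w"
      unfolding f'_def g'_def a_def[symmetric]
      using rcc[OF w _ a(1), of "conj_map y (y \<otimes> z)"] z y by (simp add: cl)
    also have "\<dots> = y \<otimes> ((u \<otimes> z) \<otimes> x)" using lcc[OF y cl(1)[OF u z] x] by (simp add: yx)
    finally show ?thesis using 1 by simp
  qed
  \<comment> \<open>Surjectivity is checked by explicit right inverses, which undo the constituent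
    translations and conjugations in reverse order.\<close>
  have ontoI: "h ` carrier Q = carrier Q"
    if "\<And>u. u \<in> carrier Q \<Longrightarrow> h u \<in> carrier Q"
      and "\<And>v. v \<in> carrier Q \<Longrightarrow> k v \<in> carrier Q \<and> h (k v) = v" for h k :: "'a \<Rightarrow> 'a"
    using that by (metis image_eqI image_subsetI subsetI subset_antisym)
  have "f ` carrier Q = carrier Q"
    by (rule ontoI[of _ "\<lambda>v. rdiv Q (conj_inv y v) x"])
      (use x y in \<open>auto simp: fcl f_def rdiv cl conj_map_conj_inv\<close>)
  moreover have "g ` carrier Q = carrier Q"
    by (rule ontoI[of _ "\<lambda>v. conj_map x (ldiv Q y v)"])
      (use x y in \<open>auto simp: fcl g_def ldiv cl conj_inv_conj_map\<close>)
  moreover have "f' ` carrier Q = carrier Q"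
    by (rule ontoI[of _ "\<lambda>v. conj_inv y (rdiv Q v w \<otimes> y)"])
      (use w y in \<open>auto simp: fcl f'_def rdiv cl conj_map_conj_inv rdiv_unique\<close>)
  moreover have "g' ` carrier Q = carrier Q"
    by (rule ontoI[of _ "\<lambda>v. ldiv Q y (conj_inv y (conj_map w v))"])
      (use w y in \<open>auto simp: fcl g'_def ldiv cl conj_map_conj_inv conj_inv_conj_map\<close>)
  ultimately have "\<exists>n\<in>nucleus Q. \<forall>u\<in>carrier Q. f' u = f u \<otimes> n"
    using nucleus_of_equal_products[of f g f' g'] eq by simp
  \<comment> \<open>At \<open>u = y\<close> the division in \<open>f'\<close> gives
    \<open>\<one>\<close>, because $T_y$ fixes \<open>y\<close>; hence \<open>f' y = w\<close>,
    while \<open>f y\<close> is $T_y(w)$.\<close>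
  then obtain n where n: "n \<in> nucleus Q" "f' y = f y \<otimes> n" using y by blast
  have "rdiv Q y y = \<one>" using y by (simp add: rdiv_unique loop_l_one loop_one_closed)
  then have "f' y = w" using y w by (simp add: f'_def conj_map_self loop_l_one)
  moreover have "f y = conj_map y w" by (simp add: f_def yx)
  ultimately have "w = conj_map y w \<otimes> n" using n(2) by metis
  then show ?thesis using n(1) unfolding nuc_equiv_def by blast
qed

section \<open>Normality of the nucleus, and multiplication modulo it\<close>

lemma conj_map_nucleus:
  assumes x: "x \<in> carrier Q" and n: "n \<in> nucleus Q"
  shows "conj_map x n \<in> nucleus Q"
proof -
  note nc = nucleusD(1)[OF n]
  obtain m where "m \<in> nucleus Q" "conj_map x n = n \<otimes> m"
    using nuc_equiv_sym[OF nuc_equiv_conj_map[OF x nc] conj_map(1)[OF x nc]]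
    unfolding nuc_equiv_def by blast
  then show ?thesis using nucleus_mult_closed[OF n] by simp
qed

lemma nucleus_move_left:
  assumes "x \<in> carrier Q" "n \<in> nucleus Q"
  obtains m where "m \<in> nucleus Q" "x \<otimes> n = m \<otimes> x"
  using conj_map_nucleus[OF assms] conj_map(2)[OF assms(1) nucleusD(1)[OF assms(2)]] by metis

text \<open>Conjugating by \<open>n\<close> instead of by \<open>x\<close> gives this direction
  without a statement about $T_x^{-1}$: $nx = T_n(x)n$, and $T_n(x)$ lies in $xN$.\<close>

lemma nucleus_move_right:
  assumes x: "x \<in> carrier Q" and n: "n \<in> nucleus Q"
  obtains m where "m \<in> nucleus Q" "n \<otimes> x = x \<otimes> m"
proof -
  note nc = nucleusD(1)[OF n]
  obtain k where k: "k \<in> nucleus Q" "conj_map n x = x \<otimes> k"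
    using nuc_equiv_sym[OF nuc_equiv_conj_map[OF nc x] conj_map(1)[OF nc x]]
    unfolding nuc_equiv_def by blast
  have "n \<otimes> x = (x \<otimes> k) \<otimes> n" using conj_map(2)[OF nc x] k by simp
  also have "\<dots> = x \<otimes> (k \<otimes> n)" by (rule nucleusD(3)[OF k(1) x nc])
  finally show ?thesis using that nucleus_mult_closed[OF k(1) n] by blast
qed

text \<open>A nuclear factor between \<open>y\<close> and \<open>z\<close> can be moved to the right
  of \<open>z\<close> and stays nuclear; this is where normality enters.\<close>

lemma nuc_equiv_mult_right:
  assumes "nuc_equiv x y" and y: "y \<in> carrier Q" and z: "z \<in> carrier Q"
  shows "nuc_equiv (x \<otimes> z) (y \<otimes> z)"
proof -
  obtain n where n: "n \<in> nucleus Q" "x = y \<otimes> n" using assms unfolding nuc_equiv_def by blast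
  obtain m where m: "m \<in> nucleus Q" "n \<otimes> z = z \<otimes> m" using nucleus_move_right[OF z n(1)] .
  have "x \<otimes> z = (y \<otimes> z) \<otimes> m" using nucleusD(3)[OF n(1) y z] nucleusD(4)[OF m(1) y z] n m by simp
  then show ?thesis using m(1) unfolding nuc_equiv_def by blast
qed

lemma nuc_equiv_commute:
  assumes x: "x \<in> carrier Q" and y: "y \<in> carrier Q"
  shows "nuc_equiv (x \<otimes> y) (y \<otimes> x)"
  using nuc_equiv_mult_right[OF nuc_equiv_sym[OF nuc_equiv_conj_map[OF x y]] y x] x y
  by (simp add: conj_map)

lemma nuc_equiv_left_commute:
  assumes x: "x \<in> carrier Q" and y: "y \<in> carrier Q" and z: "z \<in> carrier Q"
  shows "nuc_equiv (x \<otimes> (y \<otimes> z)) (y \<otimes> (x \<otimes> z))"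
  using nuc_equiv_mult_right[OF nuc_equiv_sym[OF nuc_equiv_conj_map[OF x y]] y, of "x \<otimes> z"]
    lcc[OF x y z] conj_map(1)[OF x y] x z by (simp add: loop_closed)

lemma nuc_equiv_assoc:
  assumes x: "x \<in> carrier Q" and y: "y \<in> carrier Q" and z: "z \<in> carrier Q"
  shows "nuc_equiv ((x \<otimes> y) \<otimes> z) (x \<otimes> (y \<otimes> z))"
proof -
  note cl = loop_closed
  \<comment> \<open>Commutativity brings \<open>z\<close> to the front, left commutativity exchanges
    it with \<open>x\<close>, and commutativity inside the bracket restores the order.\<close>
  have "nuc_equiv ((x \<otimes> y) \<otimes> z) (z \<otimes> (x \<otimes> y))" by (rule nuc_equiv_commute[OF cl[OF x y] z])
  moreover have "nuc_equiv (z \<otimes> (x \<otimes> y)) (x \<otimes> (z \<otimes> y))" by (rule nuc_equiv_left_commute[OF z x y])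
  moreover have "nuc_equiv (x \<otimes> (z \<otimes> y)) (x \<otimes> (y \<otimes> z))"
    by (rule nuc_equiv_mult_left[OF nuc_equiv_commute[OF z y] cl[OF y z] x])
  ultimately show ?thesis using nuc_equiv_trans x y z cl by meson
qed

section \<open>Associators: nuclear, and central in the nucleus\<close>

lemma lassociator_eq:
  assumes x: "x \<in> carrier Q" and y: "y \<in> carrier Q" and z: "z \<in> carrier Q"
  shows "(x \<otimes> (y \<otimes> z)) \<otimes> lassociator Q x y z = (x \<otimes> y) \<otimes> z"
  using assms by (simp add: lassociator_def ldiv loop_closed)

lemma rassociator_eq:
  assumes x: "x \<in> carrier Q" and y: "y \<in> carrier Q" and z: "z \<in> carrier Q"
  shows "rassociator Q x y z \<otimes> ((x \<otimes> y) \<otimes> z) = x \<otimes> (y \<otimes> z)"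
  using assms by (simp add: rassociator_def rdiv loop_closed)

lemma lassociator_unique:
  assumes "(x \<otimes> (y \<otimes> z)) \<otimes> a = (x \<otimes> y) \<otimes> z"
    and "x \<in> carrier Q" "y \<in> carrier Q" "z \<in> carrier Q" "a \<in> carrier Q"
  shows "lassociator Q x y z = a"
  using assms by (simp add: lassociator_def ldiv_unique loop_closed)

lemma lassociator_nucleus:
  assumes x: "x \<in> carrier Q" and y: "y \<in> carrier Q" and z: "z \<in> carrier Q"
  shows "lassociator Q x y z \<in> nucleus Q"
proof -
  obtain n where n: "n \<in> nucleus Q" "(x \<otimes> y) \<otimes> z = (x \<otimes> (y \<otimes> z)) \<otimes> n"
    using nuc_equiv_assoc[OF assms] unfolding nuc_equiv_def by blast
  then have "lassociator Q x y z = n"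
    using lassociator_unique[OF _ assms nucleusD(1)[OF n(1)]] by simp
  then show ?thesis using n(1) by simp
qed

lemma rassociator_nucleus:
  assumes x: "x \<in> carrier Q" and y: "y \<in> carrier Q" and z: "z \<in> carrier Q"
  shows "rassociator Q x y z \<in> nucleus Q"
proof -
  have v: "(x \<otimes> y) \<otimes> z \<in> carrier Q" and w: "x \<otimes> (y \<otimes> z) \<in> carrier Q"
    using assms by (simp_all add: loop_closed)
  obtain n where n: "n \<in> nucleus Q" "x \<otimes> (y \<otimes> z) = ((x \<otimes> y) \<otimes> z) \<otimes> n"
    using nuc_equiv_sym[OF nuc_equiv_assoc[OF assms] w] unfolding nuc_equiv_def by blast
  \<comment> \<open>The coset relation puts the nuclear factor on the right, whereas right division
    needs it on the left.\<close>
  obtain m where m: "m \<in> nucleus Q" "((x \<otimes> y) \<otimes> z) \<otimes> n = m \<otimes> ((x \<otimes> y) \<otimes> z)"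
    using nucleus_move_left[OF v n(1)] .
  have "rassociator Q x y z = m"
    unfolding rassociator_def n(2) m(2) by (rule rdiv_unique[OF refl v nucleusD(1)[OF m(1)]])
  then show ?thesis using m(1) by simp
qed

text \<open>A nuclear left factor comes out in front of both bracketings and cancels.\<close>

lemma lassociator_nucleus_mult_first:
  assumes n: "n \<in> nucleus Q" and x: "x \<in> carrier Q" and y: "y \<in> carrier Q" and z: "z \<in> carrier Q"
  shows "lassociator Q (n \<otimes> x) y z = lassociator Q x y z"
proof (rule lassociator_unique)
  note N = nucleusD[OF n] and a = nucleusD(1)[OF lassociator_nucleus[OF x y z]]
  show "((n \<otimes> x) \<otimes> (y \<otimes> z)) \<otimes> lassociator Q x y z = ((n \<otimes> x) \<otimes> y) \<otimes> z"
    using x y z a lassociator_eq[OF x y z] by (simp add: N(2)[symmetric] loop_closed)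
qed (use n x y z lassociator_nucleus nucleusD(1) loop_closed in auto)

text \<open>Nuclearity passes \<open>n\<close> to the first argument as a right factor; normality
  turns it into a left factor there. The third argument is reduced to the second in the same
  way.\<close>

lemma lassociator_nucleus_mult_second:
  assumes n: "n \<in> nucleus Q" and x: "x \<in> carrier Q" and y: "y \<in> carrier Q" and z: "z \<in> carrier Q"
  shows "lassociator Q x (n \<otimes> y) z = lassociator Q x y z"
proof -
  note N = nucleusD[OF n]
  obtain m where m: "m \<in> nucleus Q" "x \<otimes> n = m \<otimes> x" using nucleus_move_left[OF x n] .
  have "lassociator Q x (n \<otimes> y) z = lassociator Q (x \<otimes> n) y z"
    unfolding lassociator_def using N x y z by (simp add: loop_closed N(2)[symmetric])
  then show ?thesis using lassociator_nucleus_mult_first[OF m(1) x y z] m(2) by simp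
qed

lemma lassociator_nucleus_mult_third:
  assumes n: "n \<in> nucleus Q" and x: "x \<in> carrier Q" and y: "y \<in> carrier Q" and z: "z \<in> carrier Q"
  shows "lassociator Q x y (n \<otimes> z) = lassociator Q x y z"
proof -
  note N = nucleusD[OF n]
  obtain m where m: "m \<in> nucleus Q" "y \<otimes> n = m \<otimes> y" using nucleus_move_left[OF y n] .
  have "lassociator Q x y (n \<otimes> z) = lassociator Q x (y \<otimes> n) z"
    unfolding lassociator_def using N x y z by (simp add: loop_closed)
  then show ?thesis using lassociator_nucleus_mult_second[OF m(1) x y z] m(2) by simp
qed

lemma lassociator_commute_nucleus:
  assumes n: "n \<in> nucleus Q" and x: "x \<in> carrier Q" and y: "y \<in> carrier Q" and z: "z \<in> carrier Q"
  shows "lassociator Q x y z \<otimes> n = n \<otimes> lassociator Q x y z"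
proof -
  note N = nucleusD[OF n] and cl = loop_closed
  define a where "a = lassociator Q x y z"
  have a: "a \<in> nucleus Q" unfolding a_def by (rule lassociator_nucleus[OF x y z])
  note ac = nucleusD(1)[OF a]
  define w where "w = x \<otimes> (y \<otimes> z)"
  have w: "w \<in> carrier Q" using x y z cl by (simp add: w_def)
  \<comment> \<open>The associator of \<open>x\<close>, \<open>y\<close> and
    \<open>z \<otimes> n\<close> is evaluated twice: as \<open>m \<otimes> z\<close> the last
    argument leaves \<open>a\<close> unchanged, while nuclearity brings \<open>n\<close> out on the
    right of both bracketings.\<close>
  obtain m where m: "m \<in> nucleus Q" "z \<otimes> n = m \<otimes> z" using nucleus_move_left[OF z n] .
  have "lassociator Q x y (z \<otimes> n) = a"
    unfolding m(2) a_def by (rule lassociator_nucleus_mult_third[OF m(1) x y z])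
  then have "(x \<otimes> (y \<otimes> (z \<otimes> n))) \<otimes> a = (x \<otimes> y) \<otimes> (z \<otimes> n)"
    using lassociator_eq[OF x y cl[OF z N(1)]] by simp
  then have "(w \<otimes> n) \<otimes> a = ((x \<otimes> y) \<otimes> z) \<otimes> n"
    using x y z by (simp add: N(4) cl w_def)
  also have "(x \<otimes> y) \<otimes> z = w \<otimes> a"
    unfolding w_def a_def by (rule lassociator_eq[OF x y z, symmetric])
  finally have "w \<otimes> (n \<otimes> a) = w \<otimes> (a \<otimes> n)"
    using w ac N(1) by (simp add: N(3) nucleusD(3)[OF a])
  then show ?thesis
    using loop_l_cancel[OF _ w cl[OF N(1) ac] cl[OF ac N(1)]] by (simp add: a_def)
qed

text \<open>The two bracketings \<open>v\<close> and \<open>w\<close> differ by the left associator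
  \<open>a\<close>, which commutes with nuclear elements. Hence moving \<open>n\<close> past
  \<open>v\<close> or past \<open>w\<close> yields the same \<open>m\<close>, and so
  \<open>n\<close> commutes with the left factor \<open>r\<close> that takes \<open>v\<close> to
  \<open>w\<close>.\<close>

lemma rassociator_commute_nucleus:
  assumes n: "n \<in> nucleus Q" and x: "x \<in> carrier Q" and y: "y \<in> carrier Q" and z: "z \<in> carrier Q"
  shows "rassociator Q x y z \<otimes> n = n \<otimes> rassociator Q x y z"
proof -
  note N = nucleusD[OF n] and cl = loop_closed
  define a where "a = lassociator Q x y z"
  define r where "r = rassociator Q x y z"
  have a: "a \<in> nucleus Q" unfolding a_def by (rule lassociator_nucleus[OF x y z])
  have r: "r \<in> nucleus Q" unfolding r_def by (rule rassociator_nucleus[OF x y z])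
  define v where "v = (x \<otimes> y) \<otimes> z"
  define w where "w = x \<otimes> (y \<otimes> z)"
  have v: "v \<in> carrier Q" and w: "w \<in> carrier Q" using x y z cl by (simp_all add: v_def w_def)
  obtain m where m: "m \<in> nucleus Q" "n \<otimes> w = w \<otimes> m" using nucleus_move_right[OF w n] .
  note A = nucleusD[OF a] and R = nucleusD[OF r] and M = nucleusD[OF m(1)]
  have wa: "w \<otimes> a = v" unfolding w_def a_def v_def by (rule lassociator_eq[OF x y z])
  have rv: "r \<otimes> v = w" unfolding w_def r_def v_def by (rule rassociator_eq[OF x y z])
  have "n \<otimes> v = (w \<otimes> m) \<otimes> a" using N(2)[OF w A(1)] m(2) wa by simp
  also have "\<dots> = w \<otimes> (a \<otimes> m)"
    using M(3)[OF w A(1)] lassociator_commute_nucleus[OF m(1) x y z] by (simp add: a_def)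
  also have "\<dots> = v \<otimes> m" using A(3)[OF w M(1)] wa by simp
  finally have nv: "n \<otimes> v = v \<otimes> m" .
  have "(r \<otimes> n) \<otimes> v = r \<otimes> (v \<otimes> m)" using R(2)[OF N(1) v] nv by simp
  also have "\<dots> = n \<otimes> w" using R(2)[OF v M(1)] rv m(2) by simp
  also have "\<dots> = (n \<otimes> r) \<otimes> v" using N(2)[OF R(1) v] rv by simp
  finally show ?thesis
    using loop_r_cancel[OF _ v cl[OF R(1) N(1)] cl[OF N(1) R(1)]] by (simp add: r_def)
qed

lemma associators_nucleus: "associators Q \<subseteq> nucleus Q"
  unfolding associators_def using lassociator_nucleus rassociator_nucleus by blast

lemma associators_center: "associators Q \<subseteq> group_center (nucleus_group Q)"
proof
  fix a assume a: "a \<in> associators Q"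
  then have "a \<otimes> n = n \<otimes> a" if "n \<in> nucleus Q" for n
    unfolding associators_def
    using lassociator_commute_nucleus[OF that] rassociator_commute_nucleus[OF that] by blast
  then show "a \<in> group_center (nucleus_group Q)"
    using subsetD[OF associators_nucleus a] by (simp add: group_center_def)
qed

text \<open>Supplies the nonidentity element that makes the center of the nucleus
  nontrivial.\<close>

lemma lassociator_nontrivial:
  assumes "\<not> loop_associative Q"
  obtains x y z where "x \<in> carrier Q" "y \<in> carrier Q" "z \<in> carrier Q" "lassociator Q x y z \<noteq> \<one>"
proof -
  obtain x y z where xyz: "x \<in> carrier Q" "y \<in> carrier Q" "z \<in> carrier Q"
    and ne: "x \<otimes> (y \<otimes> z) \<noteq> (x \<otimes> y) \<otimes> z"
    using assms unfolding loop_associative_def by blast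
  have "lassociator Q x y z \<noteq> \<one>"
    using lassociator_eq[OF xyz] ne xyz by (auto simp: loop_r_one loop_closed)
  then show ?thesis using that xyz by blast
qed

end

theorem corollary4p3:
  fixes Q :: "('a, 'b) monoid_scheme"
  assumes "cc_loop Q" and "\<not> loop_associative Q"
  shows "group_center (nucleus_group Q) \<noteq> {\<one>\<^bsub>Q\<^esub>} \<and>
    associators Q \<subseteq> nucleus Q \<and>
    generate (nucleus_group Q) (associators Q) \<subseteq> group_center (nucleus_group Q)"
proof -
  interpret cc_loop Q by fact
  interpret N: group "nucleus_group Q" by (rule nucleus_is_group)
  obtain x y z where "x \<in> carrier Q" "y \<in> carrier Q" "z \<in> carrier Q"
    and ne: "lassociator Q x y z \<noteq> \<one>\<^bsub>Q\<^esub>"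
    using lassociator_nontrivial[OF assms(2)] .
  then have "lassociator Q x y z \<in> associators Q"
    by (auto simp: associators_def)
  then have "group_center (nucleus_group Q) \<noteq> {\<one>\<^bsub>Q\<^esub>}"
    using subsetD[OF associators_center] ne by (metis singletonD)
  moreover have "generate (nucleus_group Q) (associators Q) \<subseteq> group_center (nucleus_group Q)"
    by (rule N.generate_subgroup_incl[OF associators_center N.group_center_subgroup])
  ultimately show ?thesis using associators_nucleus by simp
qed

end
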